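(* If $Z\subset\mathbf{R}^n$ is an $(m,h)$ set, then for every $s>0$ the set $Z(s)$ of points in $\mathbf{R}^n$ at distance $\le s$ from $Z$ is also an $(m,h)$ set.
   Context: A closed subset $Z\subset\mathbf{R}^n$ (with the Euclidean metric) is an $(m,h)$ set if, whenever $f:\mathbf{R}^n\to\mathbf{R}$ is a $C^2$ function such that $f|Z$ has a local maximum at $p\in Z$, we have $\operatorname{Trace}_m(\mathrm{D}^2f(p))\le h\,|\mathrm{D}f(p)|$, where $\operatorname{Trace}_m(\mathrm{D}^2f(p))$ is the sum of the $m$ lowest eigenvalues (counted with multiplicity) of the Hessian of $f$ at $p$. *)

theory Defs
  imports "HOL-Analysis.Analysis" "HOL-Computational_Algebra.Computational_Algebra"
begin

definition grad :: "(real^'n \<Rightarrow> real) \<Rightarrow> real^'n \<Rightarrow> real^'n" where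
  "grad f x = (\<chi> i. frechet_derivative f (at x) (axis i 1))"

definition hessian :: "(real^'n \<Rightarrow> real) \<Rightarrow> real^'n \<Rightarrow> real^'n^'n" where
  "hessian f x = jacobian (grad f) (at x)"

(* frechet_derivative and jacobian are unspecified where the derivative does not exist,
   hence the two explicit differentiability conditions. *)
definition C2 :: "(real^'n \<Rightarrow> real) \<Rightarrow> bool" where
  "C2 f \<longleftrightarrow> (\<forall>x. f differentiable (at x)) \<and> (\<forall>x. grad f differentiable (at x))
     \<and> continuous_on UNIV (hessian f)"

definition charpoly :: "real^'n^'n \<Rightarrow> real poly" where
  "charpoly A = det (\<chi> i j. (if i = j then [:0, 1:] else 0) - [:A $ i $ j:])"

lemma poly_det: "poly (det M) t = det (\<chi> i j. poly (M $ i $ j) t)"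
  for M :: "real poly^'n^'n"
  by (simp add: det_def poly_sum poly_prod of_int_poly)

lemma poly_charpoly: "poly (charpoly A) t = det (mat t - A)"
  unfolding charpoly_def poly_det
  by (rule arg_cong[where f = det]) (simp add: vec_eq_iff mat_def)

(* The multiset of real roots of the characteristic polynomial: for a symmetric matrix, such as
   the Hessian of a C2 function, these are all CARD('n) eigenvalues. *)
definition eigenvalues :: "real^'n^'n \<Rightarrow> real multiset" where
  "eigenvalues A = proots (charpoly A)"

(* Meaningful for symmetric A and m \<le> CARD('n); sorted_list_of_multiset is ascending. *)
definition Trace_low :: "nat \<Rightarrow> real^'n^'n \<Rightarrow> real" where
  "Trace_low m A = sum_list (take m (sorted_list_of_multiset (eigenvalues A)))"

definition local_max_on :: "(real^'n \<Rightarrow> real) \<Rightarrow> (real^'n) set \<Rightarrow> real^'n \<Rightarrow> bool" where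
  "local_max_on f Z p \<longleftrightarrow> p \<in> Z \<and> (\<exists>e>0. \<forall>x\<in>Z. dist x p < e \<longrightarrow> f x \<le> f p)"

definition mh_set :: "nat \<Rightarrow> real \<Rightarrow> (real^'n) set \<Rightarrow> bool" where
  "mh_set m h Z \<longleftrightarrow> closed Z \<and>
     (\<forall>f p. C2 f \<and> local_max_on f Z p \<longrightarrow> Trace_low m (hessian f p) \<le> h * norm (grad f p))"

(* infdist x {} = 0 by convention, whereas the distance to the empty set should be infinite;
   hence the guard. *)
definition closed_tube :: "(real^'n) set \<Rightarrow> real \<Rightarrow> (real^'n) set" where
  "closed_tube Z s = {x. Z \<noteq> {} \<and> infdist x Z \<le> s}"

end

theory Submission
  imports Defs
begin

text \<open>If \<open>f\<close> has a local maximum on the tube at \<open>p\<close> and \<open>q\<close> is a point of \<open>Z\<close> nearest to \<open>p\<close>, then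
  translating by \<open>p - q\<close> moves \<open>Z\<close> into the tube and \<open>q\<close> to \<open>p\<close>. Hence the translate
  \<open>x \<mapsto> f (x + (p - q))\<close> has a local maximum on \<open>Z\<close> at \<open>q\<close>, with the gradient and
  Hessian that \<open>f\<close> has at \<open>p\<close>.\<close>

text \<open>Being an equivalence, this gives both functions the same set of derivatives, even where
  that set is empty. Since \<open>frechet_derivative\<close> is a \<open>SOME\<close>-choice from
  this set, \<open>grad\<close> and \<open>hessian\<close> commute with translation at every point,
  differentiable or not.\<close>

lemma has_derivative_translate_iff:
  fixes f :: "'a::real_normed_vector \<Rightarrow> 'b::real_normed_vector"
  shows "((\<lambda>y. f (y + v)) has_derivative D) (at x) \<longleftrightarrow> (f has_derivative D) (at (x + v))"
proof
  assume D: "((\<lambda>y. f (y + v)) has_derivative D) (at x)"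
  have "((\<lambda>y. y - v) has_derivative (\<lambda>y. y)) (at (x + v))"
    by (auto intro!: derivative_eq_intros)
  from has_derivative_compose[OF this, of "\<lambda>y. f (y + v)" D] D
  show "(f has_derivative D) (at (x + v))"
    by simp
next
  assume D: "(f has_derivative D) (at (x + v))"
  have "((\<lambda>y. y + v) has_derivative (\<lambda>y. y)) (at x)"
    by (auto intro!: derivative_eq_intros)
  from has_derivative_compose[OF this D]
  show "((\<lambda>y. f (y + v)) has_derivative D) (at x)" .
qed

lemma grad_translate: "grad (\<lambda>y. f (y + v)) = (\<lambda>x. grad f (x + v))"
  by (simp add: fun_eq_iff grad_def frechet_derivative_def has_derivative_translate_iff)

lemma hessian_translate: "hessian (\<lambda>y. f (y + v)) = (\<lambda>x. hessian f (x + v))"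
  by (simp add: fun_eq_iff hessian_def jacobian_def frechet_derivative_def grad_translate
      has_derivative_translate_iff)

lemma C2_translate:
  assumes "C2 f"
  shows "C2 (\<lambda>y. f (y + v))"
proof -
  have "continuous_on UNIV (\<lambda>x. hessian f (x + v))"
    using assms unfolding C2_def
    by (auto intro!: continuous_on_compose2[of UNIV "hessian f"] continuous_intros)
  with assms show ?thesis
    by (simp add: C2_def grad_translate hessian_translate differentiable_def
        has_derivative_translate_iff)
qed

lemma closed_closed_tube: "closed (closed_tube Z s)"
  by (cases "Z = {}")
    (auto simp: closed_tube_def intro!: closed_Collect_le continuous_intros)

lemma translate_mem_closed_tube:
  assumes "x \<in> Z" and "norm v \<le> s"
  shows "x + v \<in> closed_tube Z s"
  using assms infdist_le[of x Z "x + v"] by (auto simp: closed_tube_def dist_norm)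

lemma mh_set_closed_tube:
  assumes "mh_set m h Z"
  shows "mh_set m h (closed_tube Z s)"
proof -
  have "Trace_low m (hessian f p) \<le> h * norm (grad f p)"
    if "C2 f" and max: "local_max_on f (closed_tube Z s) p" for f p
  proof -
    from max obtain e where p: "p \<in> closed_tube Z s" and "e > 0"
      and e: "\<And>x. x \<in> closed_tube Z s \<Longrightarrow> dist x p < e \<Longrightarrow> f x \<le> f p"
      by (auto simp: local_max_on_def)
    \<comment> \<open>Membership of \<open>p\<close> in the tube includes the guard
      \<open>Z \<noteq> {}\<close>; as \<open>Z\<close> is also closed, the distance from
      \<open>p\<close> is attained at some \<open>q\<close>.\<close>
    have "closed Z" and "Z \<noteq> {}"
      using assms p by (auto simp: mh_set_def closed_tube_def)
    then obtain q where "q \<in> Z" and "infdist p Z = dist p q"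
      by (rule infdist_attains_inf)
    with p have v: "norm (p - q) \<le> s"
      by (simp add: closed_tube_def dist_norm)
    let ?g = "\<lambda>y. f (y + (p - q))"
    \<comment> \<open>Translation by \<open>p - q\<close> is an isometry taking \<open>q\<close> to
      \<open>p\<close>, so the radius \<open>e\<close> for \<open>f\<close> at \<open>p\<close> also
      serves for \<open>?g\<close> at \<open>q\<close>.\<close>
    have "?g x \<le> ?g q" if "x \<in> Z" "dist x q < e" for x
      using e[OF translate_mem_closed_tube[OF \<open>x \<in> Z\<close> v]] that(2)
      by (simp add: dist_norm algebra_simps)
    with \<open>q \<in> Z\<close> \<open>e > 0\<close> have "local_max_on ?g Z q"
      unfolding local_max_on_def by blast
    with assms C2_translate[OF \<open>C2 f\<close>]
    have "Trace_low m (hessian ?g q) \<le> h * norm (grad ?g q)"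
      unfolding mh_set_def by blast
    then show ?thesis
      by (simp add: hessian_translate grad_translate)
  qed
  with closed_closed_tube show ?thesis
    unfolding mh_set_def by blast
qed

theorem theorem1p8:
  fixes Z :: "(real^'n) set" and m :: nat and h :: real
  assumes "m \<le> CARD('n)" and "mh_set m h Z"
  shows "\<forall>s>0. mh_set m h (closed_tube Z s)"
  using mh_set_closed_tube[OF assms(2)] by blast

end
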